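(* Let $\Psi:(0,1]\to\mathbb{R}_+$ be a decreasing function such that $s\mapsto s\Psi(s)$ is increasing. Let $\Phi$ be a Young function with $\int^{\infty}\frac{dt}{\Phi(t)}<\infty$, and suppose that for some constant $C_0$ $$\Psi(s)\le C_0\,\Phi'(t)\qquad\text{where } s=\frac1{\Phi(t)\Phi'(t)},$$ for all sufficiently large $t$. Then there is a constant $C$, depending only on $\Phi$, $\Psi$ and $C_0$, such that for every measurable $I\subset\mathbb{R}^n$ with $0<|I|<\infty$ and every measurable $w\ge0$ on $I$, with $N=N_I^w$, $$\mathbf{n}_\Psi(N):=\int_0^\infty N(t)\Psi(N(t))\,dt\le C\,\|w\|_{L^\Phi(I)} .$$
   Context: A Young function is a continuous, non-negative, increasing, convex function $\Phi$ on $[0,\infty)$ with $\Phi(0)=0$; $\Phi'$ is its derivative (right derivative at points of non-differentiability). $\int^\infty g(t)\,dt<\infty$ means integrability near infinity. $N_I^w(t)=\frac1{|I|}|\{x\in I:w(x)>t\}|$ is the normalized distribution function; the integrand $N(t)\Psi(N(t))$ is taken to be $0$ when $N(t)=0$. The normalized Orlicz norm is $\|f\|_{L^\Phi(I)}:=\inf\{\lambda>0:\ \frac1{|I|}\int_I\Phi(|f(x)|/\lambda)\,dx\le1\}$. "Increasing"/"decreasing" are non-strict. *)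

theory Defs
  imports "HOL-Analysis.Analysis"
begin

definition young_function :: "(real \<Rightarrow> real) \<Rightarrow> bool" where
  "young_function \<Phi> \<longleftrightarrow>
     continuous_on {0..} \<Phi> \<and> (\<forall>t\<ge>0. 0 \<le> \<Phi> t) \<and> mono_on {0..} \<Phi> \<and>
     convex_on {0..} \<Phi> \<and> \<Phi> 0 = 0"

text \<open>A convex function has a right derivative everywhere in the interior of its domain, and it is
  the ordinary derivative wherever the latter exists.\<close>

definition right_deriv :: "(real \<Rightarrow> real) \<Rightarrow> real \<Rightarrow> real" where
  "right_deriv f t = vector_derivative f (at_right t)"

text \<open>The reciprocal is taken in \<^typ>\<open>ennreal\<close>, where it is infinite at \<open>0\<close>; with the real
  convention \<open>1 / 0 = 0\<close> the zero function would satisfy the condition.\<close>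

definition reciprocal_integrable_at_infinity :: "(real \<Rightarrow> real) \<Rightarrow> bool" where
  "reciprocal_integrable_at_infinity \<Phi> \<longleftrightarrow>
     (\<exists>T\<ge>0. (\<integral>\<^sup>+t\<in>{T..}. 1 / ennreal (\<Phi> t) \<partial>lborel) < \<infinity>)"

text \<open>Lebesgue measure on \<open>n\<close>-dimensional space with its Lebesgue measurable sets.  Points are
  functions on \<open>{..<n}\<close> (extended by \<^const>\<open>undefined\<close>), so that \<open>n\<close> is a number rather than a
  type and a constant can be required to be independent of it.\<close>

definition lebesgue_Rn :: "nat \<Rightarrow> (nat \<Rightarrow> real) measure" where
  "lebesgue_Rn n = completion (\<Pi>\<^sub>M i\<in>{..<n}. lborel)"

definition normalized_distribution :: "'a measure \<Rightarrow> 'a set \<Rightarrow> ('a \<Rightarrow> real) \<Rightarrow> real \<Rightarrow> real" where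
  "normalized_distribution M I w t = measure M {x \<in> I. w x > t} / measure M I"

definition n_functional :: "(real \<Rightarrow> real) \<Rightarrow> (real \<Rightarrow> real) \<Rightarrow> ennreal" where
  "n_functional \<Psi> N = (\<integral>\<^sup>+t\<in>{0..}. ennreal (if N t = 0 then 0 else N t * \<Psi> (N t)) \<partial>lborel)"

text \<open>The norm is \<open>\<infinity>\<close> (the infimum of the empty set) if no \<open>\<lambda>\<close> is admissible.\<close>

definition orlicz_norm ::
    "(real \<Rightarrow> real) \<Rightarrow> 'a measure \<Rightarrow> 'a set \<Rightarrow> ('a \<Rightarrow> real) \<Rightarrow> ennreal" where
  "orlicz_norm \<Phi> M I f =
     Inf {ennreal l | l. 0 < l \<and>
       (\<integral>\<^sup>+x\<in>I. ennreal (\<Phi> (\<bar>f x\<bar> / l)) \<partial>M) / emeasure M I \<le> 1}"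

end

theory Submission
  imports Defs
begin

text \<open>By scaling one may assume that the mean of \<open>\<Phi>(w)\<close> over \<open>I\<close> is at most \<open>1\<close>, which by Tonelli
  bounds \<open>\<integral> \<Phi>'(t) N(t) dt\<close> by \<open>1\<close>.  For small \<open>t\<close> one has \<open>N \<Psi>(N) \<le> \<Psi>(1)\<close>.  For large \<open>t\<close> put
  \<open>s = 1 / (\<Phi>(t) \<Phi>'(t))\<close>: if \<open>N(t) \<ge> s\<close> then \<open>N \<Psi>(N) \<le> N \<Psi>(s) \<le> C\<^sub>0 \<Phi>'(t) N(t)\<close>, and otherwise
  \<open>N \<Psi>(N) \<le> s \<Psi>(s) \<le> C\<^sub>0 / \<Phi>(t)\<close>.  Both bounds are integrable.\<close>

section \<open>Right derivatives of increasing convex functions\<close>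

text \<open>By convexity the slopes \<open>(f u - f t) / (u - t)\<close> increase with
  \<open>u\<close>, and monotonicity of \<open>f\<close> keeps them nonnegative, so they converge to
  their infimum as \<open>u\<close> decreases to \<open>t\<close>. The lower bound covers the
  endpoint \<open>t = a\<close> too, where convexity alone would permit slopes tending to minus
  infinity.\<close>

lemma right_deriv_eq_INF_slopes:
  fixes f :: "real \<Rightarrow> real"
  assumes f: "convex_on {a..} f" "mono_on {a..} f" and t: "a \<le> t"
  shows "right_deriv f t = (INF u\<in>{t<..}. (f u - f t) / (u - t))"
    and "bdd_below ((\<lambda>u. (f u - f t) / (u - t)) ` {t<..})"
proof -
  let ?q = "\<lambda>u. (f u - f t) / (u - t)"
  have pos: "0 \<le> ?q u" if "t < u" for u
    using that t mono_onD[OF f(2), of t u] by simp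
  then show bdd: "bdd_below (?q ` {t<..})"
    by (intro bdd_belowI[of _ 0]) auto
  have mono: "?q u \<le> ?q v" if "t < u" "u \<le> v" for u v
  proof (cases "u = v")
    case False
    then have "(f t - f u) / (t - u) \<le> (f t - f v) / (t - v)"
      using that t by (intro convex_on_slope_le[OF f(1)]) auto
    then show ?thesis
      by (metis minus_diff_eq minus_divide_divide)
  qed simp
  let ?L = "INF u\<in>{t<..}. ?q u"
  have "(?q \<longlongrightarrow> ?L) (at_right t)"
  proof (rule order_tendstoI)
    fix c assume "c < ?L"
    then have "c < ?q u" if "t < u" for u
      using cINF_lower[OF bdd, of u] that by force
    then show "\<forall>\<^sub>F u in at_right t. c < ?q u"
      by (intro eventually_at_right_less[THEN eventually_mono])
  next
    fix c assume "?L < c"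
    then obtain v where v: "t < v" "?q v < c"
      using cINF_less_iff[OF _ bdd] by auto
    show "\<forall>\<^sub>F u in at_right t. ?q u < c"
      unfolding eventually_at_right[OF v(1)]
      using mono v by (intro exI[of _ v]) (meson le_less_trans less_imp_le)
  qed
  then have "(f has_field_derivative ?L) (at_right t)"
    by (simp add: has_field_derivative_iff)
  then show "right_deriv f t = ?L"
    unfolding right_deriv_def
    by (intro vector_derivative_within)
      (simp_all add: has_real_derivative_iff_has_vector_derivative)
qed

lemma right_deriv_le_slope:
  fixes f :: "real \<Rightarrow> real"
  assumes "convex_on {a..} f" "mono_on {a..} f" "a \<le> t" "t < u"
  shows "right_deriv f t \<le> (f u - f t) / (u - t)"
  using assms cINF_lower[OF right_deriv_eq_INF_slopes(2)[OF assms(1-3)], of u]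
  by (simp add: right_deriv_eq_INF_slopes(1)[OF assms(1-3)])

lemma slope_le_right_deriv:
  fixes f :: "real \<Rightarrow> real"
  assumes f: "convex_on {a..} f" "mono_on {a..} f" and st: "a \<le> s" "s < t"
  shows "(f t - f s) / (t - s) \<le> right_deriv f t"
proof -
  have "(f t - f s) / (t - s) \<le> (f u - f t) / (u - t)" if "t < u" for u
  proof -
    \<comment> \<open>The chord from \<open>s\<close> to \<open>u\<close> has a slope between those
      of the chords over \<open>[s, t]\<close> and \<open>[t, u]\<close>.\<close>
    have "(f s - f t) / (s - t) \<le> (f s - f u) / (s - u)" "(f s - f u) / (s - u) \<le> (f t - f u) / (t - u)"
      using that st by (auto intro!: convex_on_slope_le[OF f(1)])
    then show ?thesis
      by (metis minus_diff_eq minus_divide_divide order_trans)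
  qed
  then show ?thesis
    using st by (subst right_deriv_eq_INF_slopes(1)[OF f]) (auto intro!: cINF_greatest)
qed

text \<open>The slope of the chord from \<open>s\<close> to \<open>t\<close> separates the two right
  derivatives. Measurability of the right derivative will come from this monotonicity.\<close>

lemma mono_on_right_deriv:
  fixes f :: "real \<Rightarrow> real"
  assumes f: "convex_on {a..} f" "mono_on {a..} f"
  shows "mono_on {a..} (right_deriv f)"
proof (rule mono_onI)
  fix s t assume "s \<in> {a..}" "t \<in> {a..}" "s \<le> t"
  then show "right_deriv f s \<le> right_deriv f t"
    using right_deriv_le_slope[OF f, of s t] slope_le_right_deriv[OF f, of s t]
    by (cases "s = t") auto
qed

lemma nn_integral_right_deriv_le:
  fixes f :: "real \<Rightarrow> real"
  assumes f: "convex_on {a..} f" "mono_on {a..} f" "continuous_on {a..} f" and w: "a \<le> w"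
  shows "(\<integral>\<^sup>+t\<in>{a..<w}. ennreal (right_deriv f t) \<partial>lborel) \<le> ennreal (f w - f a)"
proof -
  \<comment> \<open>\<open>f'\<close> is at most the difference quotient \<open>(f(t + h) - f(t)) / h\<close>, whose integral telescopes;
    then \<open>h \<rightarrow> 0\<close>.\<close>
  let ?X = "\<integral>\<^sup>+t\<in>{a..<w}. ennreal (right_deriv f t) \<partial>lborel"
  have le: "?X \<le> ennreal (f (w + h) - f a)" if h: "0 < h" for h
  proof -
    let ?q = "\<lambda>t. (f (t + h) - f t) / h"
    have f_int: "f integrable_on {c..d}" if "a \<le> c" for c d
      using that by (intro integrable_continuous_real continuous_on_subset[OF f(3)]) auto
    have cont: "continuous_on {a..w} (\<lambda>t. f (t + h))" 
      using h by (intro continuous_on_compose2[OF f(3)] continuous_intros) auto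
    have q_int: "?q integrable_on {a..w}"
      using h by (intro integrable_continuous_real continuous_intros cont continuous_on_subset[OF f(3)]) auto
    have q_nonneg: "0 \<le> ?q t" if "a \<le> t" for t
      using mono_onD[OF f(2), of t "t + h"] that h by simp
    have "?X \<le> (\<integral>\<^sup>+t. ennreal (?q t) * indicator {a..w} t \<partial>lborel)"
    proof (rule nn_integral_mono)
      fix t
      show "ennreal (right_deriv f t) * indicator {a..<w} t \<le> ennreal (?q t) * indicator {a..w} t"
        using right_deriv_le_slope[OF f(1,2), of t "t + h"] h
        by (auto simp: indicator_def intro!: ennreal_leI)
    qed
    also have "\<dots> = ennreal (integral {a..w} ?q)"
      using q_nonneg q_int by (intro nn_integral_has_integral_lebesgue' integrable_integral) auto
    also have "integral {a..w} ?q \<le> f (w + h) - f a"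
    proof -
      have "integral {a..w} ?q = (integral {a..w} (\<lambda>t. f (t + h)) - integral {a..w} f) / h"
        using integrable_continuous_real[OF cont] f_int[of a w]
        by (simp add: integral_diff)
      moreover have "integral {a..w} (\<lambda>t. f (t + h)) = integral {a + h..w + h} f"
        using integral_shift[where a = a and b = w and c = h and f = f] continuous_on_subset[OF f(3), of "{a+h..w+h}"] h
        by (simp add: o_def add.commute)
      \<comment> \<open>Splitting \<open>[a, w + h]\<close> at \<open>a + h\<close> and at
        \<open>w\<close> leaves the integral over \<open>[w, w + h]\<close> minus that over
        \<open>[a, a + h]\<close>, whether or not \<open>a + h \<le> w\<close>. Monotonicity bounds
        the first by \<open>h * f (w + h)\<close> from above and the second by
        \<open>h * f a\<close> from below.\<close>
      moreover have "integral {a..a + h} f + integral {a + h..w + h} f = integral {a..w + h} f"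
        "integral {a..w} f + integral {w..w + h} f = integral {a..w + h} f"
        using h w f_int by (intro Henstock_Kurzweil_Integration.integral_combine; simp)+
      moreover have "integral {w..w + h} f \<le> integral {w..w + h} (\<lambda>_. f (w + h))"
        using w h by (intro integral_le f_int mono_onD[OF f(2)]) auto
      moreover have "integral {a..a + h} (\<lambda>_. f a) \<le> integral {a..a + h} f"
        using h by (intro integral_le f_int mono_onD[OF f(2)]) auto
      ultimately show ?thesis
        using h by (simp add: field_simps)
    qed
    finally show ?thesis
      by (simp add: ennreal_leI)
  qed
  \<comment> \<open>For \<open>h > 0\<close> the point \<open>w + h\<close> stays in
    \<open>{a..}\<close>, so continuity relative to \<open>{a..}\<close> suffices, even at
    \<open>w = a\<close>.\<close>
  have "filterlim (\<lambda>h. w + h) (at w within {a..}) (at_right 0)"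
    using w unfolding filterlim_at
    by (auto intro!: tendsto_eq_intros eventually_at_rightI[of 0 1])
  moreover have "(f \<longlongrightarrow> f w) (at w within {a..})"
    using f(3) w by (simp add: continuous_on_def)
  ultimately have "((\<lambda>h. f (w + h)) \<longlongrightarrow> f w) (at_right 0)"
    by (rule filterlim_compose[rotated])
  then have "((\<lambda>h. ennreal (f (w + h) - f a)) \<longlongrightarrow> ennreal (f w - f a)) (at_right 0)"
    by (intro tendsto_intros)
  then show ?thesis
    by (rule tendsto_lowerbound)
      (auto intro!: eventually_at_right_less[THEN eventually_mono] le)
qed

section \<open>Linear growth of the Young function\<close>

text \<open>Beyond a point \<open>t0\<close> with \<open>\<Phi> t0 > 0\<close>, convexity puts
  \<Phi> above the line through the origin and \<open>(t0, \<Phi> t0)\<close>, and the slope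
  \<open>c\<close> of that line also bounds the right derivative from below. Consequently
  \<open>1 / (\<Phi> t * right_deriv \<Phi> t)\<close> lies in \<open>(0, 1]\<close>, the domain of
  \<Psi>, for large \<open>t\<close>.\<close>

lemma young_eventually_ge_1:
  assumes \<Phi>: "young_function \<Phi>" "reciprocal_integrable_at_infinity \<Phi>"
  shows "\<forall>\<^sub>F t in at_top. 0 < \<Phi> t \<and> 0 < right_deriv \<Phi> t \<and> 1 \<le> \<Phi> t * right_deriv \<Phi> t"
proof -
  have conv: "convex_on {0..} \<Phi>" and mono: "mono_on {0..} \<Phi>" and \<Phi>0: "\<Phi> 0 = 0"
    and nonneg: "\<And>t. 0 \<le> t \<Longrightarrow> 0 \<le> \<Phi> t"
    using \<Phi>(1) by (auto simp: young_function_def)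
  obtain T where T: "0 \<le> T" "(\<integral>\<^sup>+t\<in>{T..}. 1 / ennreal (\<Phi> t) \<partial>lborel) < \<infinity>"
    using \<Phi>(2) by (auto simp: reciprocal_integrable_at_infinity_def)
  have "\<exists>t\<ge>T. \<Phi> t > 0"
  proof (rule ccontr)
    assume "\<not> (\<exists>t\<ge>T. \<Phi> t > 0)"
    \<comment> \<open>In \<open>ennreal\<close> the reciprocal of 0 is \<open>top\<close>, so a
      \<Phi> vanishing on \<open>{T..}\<close> would have an infinite integral there.\<close>
    then have "(\<integral>\<^sup>+t\<in>{T..}. 1 / ennreal (\<Phi> t) \<partial>lborel) = (\<integral>\<^sup>+t. top * indicator {T..} t \<partial>lborel)"
      by (intro nn_integral_cong) (auto simp: indicator_def not_less ennreal_neg)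
    also have "\<dots> = top"
    proof -
      have "emeasure lborel {T..T+1} \<le> emeasure lborel {T..}"
        by (intro emeasure_mono) auto
      then have "emeasure lborel {T..} \<noteq> 0"
        by auto
      then show ?thesis
        by (subst nn_integral_cmult_indicator) (auto simp: ennreal_top_mult)
    qed
    finally show False
      using T by simp
  qed
  then obtain t0 where t0: "T \<le> t0" "0 < \<Phi> t0"
    by auto
  define c where "c = \<Phi> t0 / t0"
  have "0 < t0"
    using T t0 \<Phi>0 by (cases "t0 = 0") auto
  then have c: "0 < c"
    using t0 by (simp add: c_def)
  have ge: "c * t \<le> \<Phi> t \<and> c \<le> right_deriv \<Phi> t" if "t0 < t" for t
  proof -
    have "(\<Phi> 0 - \<Phi> t0) / (0 - t0) \<le> (\<Phi> 0 - \<Phi> t) / (0 - t)"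
      using that \<open>0 < t0\<close> by (intro convex_on_slope_le[OF conv]) auto
    moreover have "(\<Phi> t - \<Phi> 0) / (t - 0) \<le> right_deriv \<Phi> t"
      using that \<open>0 < t0\<close> by (intro slope_le_right_deriv[OF conv mono]) auto
    ultimately have "c \<le> \<Phi> t / t" "\<Phi> t / t \<le> right_deriv \<Phi> t"
      by (simp_all add: c_def \<Phi>0)
    moreover from this have "c \<le> right_deriv \<Phi> t"
      by linarith
    ultimately show ?thesis
      using that \<open>0 < t0\<close> by (simp add: pos_le_divide_eq)
  qed
  \<comment> \<open>The threshold \<open>1 / c^2\<close> is what makes
    \<open>(c * t) * c \<ge> 1\<close>.\<close>
  show ?thesis
    using eventually_gt_at_top[of t0] eventually_ge_at_top[of "1 / c^2"]
  proof eventually_elim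
    case (elim t)
    have "1 \<le> (c * t) * c"
      using elim c by (simp add: field_simps power2_eq_square)
    also have "\<dots> \<le> \<Phi> t * right_deriv \<Phi> t"
      using ge[OF elim(1)] c elim \<open>0 < t0\<close> by (intro mult_mono) (auto intro: nonneg)
    finally have "1 \<le> \<Phi> t * right_deriv \<Phi> t" .
    moreover have "0 < c * t" using c elim \<open>0 < t0\<close> by simp
    ultimately show ?case
      using ge[OF elim(1)] c by linarith
  qed
qed

section \<open>Measurability and the Tonelli bound for superlevel sets\<close>

text \<open>Composing with \<open>max a\<close> extends \<open>f\<close> by the constant
  \<open>f a\<close> to a monotone function on the whole line; the indicator hides the
  extension.\<close>

lemma borel_measurable_mono_on_Ici:
  fixes f :: "real \<Rightarrow> real"
  assumes "mono_on {a..} f"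
  shows "(\<lambda>t. ennreal (f t) * indicator {a..} t) \<in> borel_measurable borel"
proof -
  have [measurable]: "(\<lambda>t. f (max a t)) \<in> borel_measurable borel"
    by (intro borel_measurable_mono monoI mono_onD[OF assms]) auto
  have "(\<lambda>t. ennreal (f (max a t)) * indicator {a..} t) \<in> borel_measurable borel"
    by measurable
  then show ?thesis
    by (rule measurable_cong[THEN iffD1, rotated]) (auto simp: indicator_def)
qed

text \<open>A layer-cake inequality: after exchanging the integrals, the inner one is the integral
  of the right derivative over \<open>[0, w x)\<close>, which is at most
  \<open>f (w x) - f 0\<close>.\<close>

lemma nn_integral_right_deriv_mult_emeasure_le:
  fixes f w :: "_ \<Rightarrow> real"
  assumes f: "convex_on {0..} f" "mono_on {0..} f" "continuous_on {0..} f"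
    and I: "I \<in> sets M" "emeasure M I < \<infinity>"
    and w: "w \<in> borel_measurable (restrict_space M I)" "\<And>x. x \<in> I \<Longrightarrow> 0 \<le> w x"
  shows "(\<integral>\<^sup>+t\<in>{0..}. ennreal (right_deriv f t) * emeasure M {x\<in>I. w x > t} \<partial>lborel)
    \<le> (\<integral>\<^sup>+x\<in>I. ennreal (f (w x) - f 0) \<partial>M)"
proof -
  let ?R = "restrict_space M I"
  define g where "g t = ennreal (right_deriv f t) * indicator {0..} t" for t
  have [measurable]: "g \<in> borel_measurable borel"
    unfolding g_def by (rule borel_measurable_mono_on_Ici[OF mono_on_right_deriv[OF f(1,2)]])
  note [measurable] = w(1)
  have I_space: "I \<inter> space M \<in> sets M" "space ?R = I"
    using sets.sets_into_space[OF I(1)] I(1) by (auto simp: space_restrict_space)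
  \<comment> \<open>Finiteness on \<open>I\<close> gives the sigma-finiteness that Tonelli requires,
    for an arbitrary \<open>M\<close>.\<close>
  have "finite_measure ?R"
    using I I_space by (intro finite_measureI) (simp add: emeasure_restrict_space)
  then interpret R: finite_measure ?R .
  interpret pair_sigma_finite lborel ?R
    by unfold_locales
  let ?F = "\<lambda>t x. g t * indicator {..<w x} t"
  have [measurable]: "case_prod ?F \<in> borel_measurable (lborel \<Otimes>\<^sub>M ?R)"
    unfolding indicator_def lessThan_iff by measurable
  have "(\<integral>\<^sup>+t\<in>{0..}. ennreal (right_deriv f t) * emeasure M {x\<in>I. w x > t} \<partial>lborel)
      = (\<integral>\<^sup>+t. (\<integral>\<^sup>+x. ?F t x \<partial>?R) \<partial>lborel)"
  proof (rule nn_integral_cong)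
    fix t
    have "{x \<in> space ?R. t < w x} \<in> sets ?R"
      by measurable
    then have "{x \<in> I. t < w x} \<in> sets ?R"
      by (simp add: I_space)
    then have "emeasure M {x \<in> I. t < w x} = (\<integral>\<^sup>+x. indicator {x\<in>I. t < w x} x \<partial>?R)"
      using I_space by (simp add: emeasure_restrict_space)
    then have "g t * emeasure M {x \<in> I. t < w x}
        = (\<integral>\<^sup>+x. g t * indicator {x\<in>I. t < w x} x \<partial>?R)"
      using \<open>{x \<in> I. t < w x} \<in> sets ?R\<close> by (simp add: nn_integral_cmult)
    moreover have "(\<integral>\<^sup>+x. g t * indicator {x\<in>I. t < w x} x \<partial>?R) = (\<integral>\<^sup>+x. ?F t x \<partial>?R)"
      using I_space by (intro nn_integral_cong) (auto simp: indicator_def)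
    ultimately show "ennreal (right_deriv f t) * emeasure M {x \<in> I. t < w x} * indicator {0..} t
        = (\<integral>\<^sup>+x. ?F t x \<partial>?R)"
      by (simp add: g_def mult_ac)
  qed
  also have "\<dots> = (\<integral>\<^sup>+x. (\<integral>\<^sup>+t. ?F t x \<partial>lborel) \<partial>?R)"
    by (rule Fubini'[symmetric]) measurable
  also have "\<dots> \<le> (\<integral>\<^sup>+x. ennreal (f (w x) - f 0) \<partial>?R)"
  proof (rule nn_integral_mono)
    fix x assume "x \<in> space ?R"
    then have "0 \<le> w x"
      using w(2) by (simp add: I_space)
    have "(\<integral>\<^sup>+t. ?F t x \<partial>lborel) = (\<integral>\<^sup>+t\<in>{0..<w x}. ennreal (right_deriv f t) \<partial>lborel)"
      by (intro nn_integral_cong) (auto simp: indicator_def g_def)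
    also have "\<dots> \<le> ennreal (f (w x) - f 0)"
      by (rule nn_integral_right_deriv_le[OF f \<open>0 \<le> w x\<close>])
    finally show "(\<integral>\<^sup>+t. ?F t x \<partial>lborel) \<le> ennreal (f (w x) - f 0)" .
  qed
  also have "\<dots> = (\<integral>\<^sup>+x\<in>I. ennreal (f (w x) - f 0) \<partial>M)"
    by (rule nn_integral_restrict_space[OF I_space(1)])
  finally show ?thesis .
qed

section \<open>Change of variables in the functional\<close>

lemma borel_measurable_antimono:
  fixes f :: "real \<Rightarrow> real"
  assumes "antimono f"
  shows "f \<in> borel_measurable borel"
proof -
  have "(\<lambda>x. - f x) \<in> borel_measurable borel"
    using assms by (intro borel_measurable_mono) (auto simp: mono_def antimono_def)
  then show ?thesis
    by simp
qed

lemma n_functional_scale: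
  assumes \<Psi>: "\<forall>s\<in>{0<..1}. 0 \<le> \<Psi> s" "mono_on {0<..1} (\<lambda>s. s * \<Psi> s)"
    and N: "antimono N" "\<And>t. 0 \<le> N t" "\<And>t. N t \<le> 1" and l: "0 < l"
  shows "n_functional \<Psi> N = ennreal l * n_functional \<Psi> (\<lambda>t. N (l * t))"
proof -
  define F where "F t = (if N t = 0 then 0 else N t * \<Psi> (N t))" for t
  have F_nonneg: "0 \<le> F t" for t
    using \<Psi>(1) N(2,3)[of t] by (auto simp: F_def)
  \<comment> \<open>An increasing function \<open>s * \<Psi> s\<close> is composed with a decreasing
    \<open>N\<close>; the default value 0 at \<open>N t = 0\<close> fits because \<open>F\<close> is
    nonnegative. This yields the measurability for the substitution.\<close>
  have "antimono F"
  proof (rule antimonoI)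
    fix s t :: real assume "s \<le> t"
    then have "N t \<le> N s"
      using N(1) by (simp add: antimonoD)
    show "F t \<le> F s"
    proof (cases "N t = 0")
      case True
      then show ?thesis
        using F_nonneg[of s] by (simp add: F_def)
    next
      case False
      then have "0 < N t"
        using N(2)[of t] by simp
      then show ?thesis
        using mono_onD[OF \<Psi>(2), of "N t" "N s"] \<open>N t \<le> N s\<close> N(3) by (auto simp: F_def)
    qed
  qed
  then have [measurable]: "F \<in> borel_measurable borel"
    by (rule borel_measurable_antimono)
  have "n_functional \<Psi> N = (\<integral>\<^sup>+t\<in>{0..}. ennreal (F t) \<partial>lborel)"
    by (simp add: n_functional_def F_def)
  also have "\<dots> = ennreal l * (\<integral>\<^sup>+t. ennreal (F (0 + l * t)) * indicator {0..} (0 + l * t) \<partial>lborel)"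
    using l by (subst nn_integral_real_affine[where c = l and t = 0]) auto
  also have "(\<integral>\<^sup>+t. ennreal (F (0 + l * t)) * indicator {0..} (0 + l * t) \<partial>lborel)
      = n_functional \<Psi> (\<lambda>t. N (l * t))"
    unfolding n_functional_def F_def
    using l by (intro nn_integral_cong) (auto simp: indicator_def zero_le_mult_iff)
  finally show ?thesis .
qed

section \<open>The uniform bound in the normalized case\<close>

text \<open>\<open>C\<close> is fixed before \<open>N\<close> is introduced, which makes it
  independent of dimension, set and weight.\<close>

lemma n_functional_bounded:
  assumes \<Psi>: "\<forall>s\<in>{0<..1}. 0 \<le> \<Psi> s" "antimono_on {0<..1} \<Psi>" "mono_on {0<..1} (\<lambda>s. s * \<Psi> s)"
    and \<Phi>: "young_function \<Phi>" "reciprocal_integrable_at_infinity \<Phi>"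
    and le: "\<forall>\<^sub>F t in at_top. \<Psi> (1 / (\<Phi> t * right_deriv \<Phi> t)) \<le> C0 * right_deriv \<Phi> t"
  obtains C :: real where "0 < C"
    "\<And>N. \<lbrakk>antimono N; \<And>t. 0 \<le> N t; \<And>t. N t \<le> 1;
      (\<integral>\<^sup>+t\<in>{0..}. ennreal (right_deriv \<Phi> t) * ennreal (N t) \<partial>lborel) \<le> 1\<rbrakk>
      \<Longrightarrow> n_functional \<Psi> N \<le> ennreal C"
proof -
  let ?g = "right_deriv \<Phi>"
  have conv: "convex_on {0..} \<Phi>" and mono: "mono_on {0..} \<Phi>"
    using \<Phi>(1) by (auto simp: young_function_def)
  obtain T0 where T0: "0 \<le> T0" "(\<integral>\<^sup>+t\<in>{T0..}. 1 / ennreal (\<Phi> t) \<partial>lborel) < \<infinity>"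
    using \<Phi>(2) by (auto simp: reciprocal_integrable_at_infinity_def)
  obtain T1 where T1: "\<And>t. T1 \<le> t \<Longrightarrow> 0 < \<Phi> t \<and> 0 < ?g t \<and> 1 \<le> \<Phi> t * ?g t
      \<and> \<Psi> (1 / (\<Phi> t * ?g t)) \<le> C0 * ?g t"
    using eventually_conj[OF young_eventually_ge_1[OF \<Phi>] le]
    unfolding eventually_at_top_linorder by auto
  define T where "T = max T0 T1"
  define B where "B = \<bar>C0\<bar>"
  define K where "K = (\<integral>\<^sup>+t\<in>{T..}. 1 / ennreal (\<Phi> t) \<partial>lborel)"
  have "K \<le> (\<integral>\<^sup>+t\<in>{T0..}. 1 / ennreal (\<Phi> t) \<partial>lborel)"
    unfolding K_def by (intro nn_integral_mono) (auto simp: indicator_def T_def)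
  then have K: "K < top"
    using T0 by (auto intro: le_less_trans)
  have T: "0 \<le> T" "T0 \<le> T" "T1 \<le> T" and B: "0 \<le> B" and \<Psi>1: "0 \<le> \<Psi> 1"
    using T0 \<Psi>(1) by (auto simp: T_def B_def)
  \<comment> \<open>The summands bound, in order, the integral over \<open>[0, T)\<close>, the part
    controlled by the integral of \<Phi>' N, and the tail of 1/\<Phi>; the final 1 ensures strict
    positivity.\<close>
  define C where "C = \<Psi> 1 * T + B + B * enn2real K + 1"
  have C: "0 < C"
    unfolding C_def using T B \<Psi>1 by (intro add_nonneg_pos add_nonneg_nonneg mult_nonneg_nonneg) auto
  show thesis
  proof (rule that[OF C])
    fix N :: "real \<Rightarrow> real"
    assume N: "antimono N" "\<And>t. 0 \<le> N t" "\<And>t. N t \<le> 1"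
      and N_int: "(\<integral>\<^sup>+t\<in>{0..}. ennreal (?g t) * ennreal (N t) \<partial>lborel) \<le> 1"
    have [measurable]: "N \<in> borel_measurable borel"
      using N(1) by (rule borel_measurable_antimono)
    \<comment> \<open>At every \<open>t\<close> one of \<open>?a\<close>, \<open>B * ?b\<close>,
      \<open>B * ?c\<close> dominates the integrand. \<open>?b\<close> lives on all of
      \<open>{0..}\<close> so that the hypothesis on \<open>N\<close> applies to it as it
      stands.\<close>
    let ?a = "\<lambda>t. ennreal (\<Psi> 1) * indicator {0..<T} t"
    let ?b = "\<lambda>t. ennreal (?g t) * ennreal (N t) * indicator {0..} t"
    let ?c = "\<lambda>t. 1 / ennreal (\<Phi> t) * indicator {T..} t"
    have [measurable]: "?b \<in> borel_measurable borel"
    proof -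
      note [measurable] = borel_measurable_mono_on_Ici[OF mono_on_right_deriv[OF conv mono]]
      have "(\<lambda>t. (ennreal (?g t) * indicator {0..} t) * ennreal (N t)) \<in> borel_measurable borel"
        by measurable
      then show ?thesis
        by (simp add: mult_ac)
    qed
    have [measurable]: "?c \<in> borel_measurable borel"
    proof -
      note [measurable] = borel_measurable_mono_on_Ici[OF mono]
      have "(\<lambda>t. 1 / (ennreal (\<Phi> t) * indicator {0..} t) * indicator {T..} t) \<in> borel_measurable borel"
        by measurable
      then show ?thesis
        using T by (elim measurable_cong[THEN iffD1, rotated]) (auto simp: indicator_def)
    qed
    have "n_functional \<Psi> N \<le> (\<integral>\<^sup>+t. ?a t + ennreal B * ?b t + ennreal B * ?c t \<partial>lborel)"
      unfolding n_functional_def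
    proof (rule nn_integral_mono)
      fix t
      consider "t < 0 \<or> N t = 0" | "0 \<le> t" "t < T" "0 < N t" | "T \<le> t" "0 < N t"
        using N(2)[of t] by linarith
      then show "ennreal (if N t = 0 then 0 else N t * \<Psi> (N t)) * indicator {0..} t
          \<le> ?a t + ennreal B * ?b t + ennreal B * ?c t"
      proof cases
        case 1
        then show ?thesis
          by auto
      next
        case 2
        then have "N t * \<Psi> (N t) \<le> \<Psi> 1"
          using mono_onD[OF \<Psi>(3), of "N t" 1] N(3) by simp
        then have "ennreal (if N t = 0 then 0 else N t * \<Psi> (N t)) * indicator {0..} t \<le> ?a t"
          using 2 by (simp add: ennreal_leI)
        then show ?thesis
          by (simp add: add_increasing2 add.assoc)
      next
        case 3
        define s where "s = 1 / (\<Phi> t * ?g t)"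
        \<comment> \<open>The bound \<open>s \<le> 1\<close> matters: both monotonicity hypotheses
          on \<Psi> hold only on \<open>(0, 1]\<close>.\<close>
        have pos: "0 < \<Phi> t" "0 < ?g t" "0 < s" "s \<le> 1" and "\<Psi> s \<le> C0 * ?g t"
          using T1[of t] T 3 by (auto simp: s_def)
        moreover have "C0 * ?g t \<le> B * ?g t"
          using pos by (simp add: B_def)
        ultimately have \<Psi>s: "\<Psi> s \<le> B * ?g t"
          by linarith
        have "N t * \<Psi> (N t) \<le> B * (?g t * N t) \<or> N t * \<Psi> (N t) \<le> B * (1 / \<Phi> t)"
        proof (cases "s \<le> N t")
          case True
          then have "\<Psi> (N t) \<le> B * ?g t"
            using monotone_onD[OF \<Psi>(2), of s "N t"] pos N(3)[of t] \<Psi>s by auto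
          then show ?thesis
            using 3 by (simp add: mult.commute mult.left_commute mult_left_mono)
        next
          case False
          then have "N t * \<Psi> (N t) \<le> s * \<Psi> s"
            using mono_onD[OF \<Psi>(3), of "N t" s] 3 pos by simp
          also have "\<dots> \<le> s * (B * ?g t)"
            using \<Psi>s pos by (intro mult_left_mono) auto
          also have "\<dots> = B * (1 / \<Phi> t)"
            using pos by (simp add: s_def)
          finally show ?thesis by simp
        qed
        moreover have "ennreal (B * (?g t * N t)) = ennreal B * ?b t"
          using 3 T pos B by (simp add: ennreal_mult)
        moreover have "ennreal (B * (1 / \<Phi> t)) = ennreal B * ?c t"
          using 3 T pos B divide_ennreal[of 1 "\<Phi> t"] ennreal_mult[of B "1 / \<Phi> t"] by simp
        ultimately have "ennreal (N t * \<Psi> (N t)) \<le> ennreal B * ?b t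
            \<or> ennreal (N t * \<Psi> (N t)) \<le> ennreal B * ?c t"
          by (metis ennreal_leI)
        then have "ennreal (N t * \<Psi> (N t)) \<le> ?a t + ennreal B * ?b t + ennreal B * ?c t"
          by (metis add.commute add_increasing2 order_trans le_iff_add zero_le)
        then show ?thesis
          using 3 T by simp
      qed
    qed
    also have "\<dots> = ennreal (\<Psi> 1) * ennreal T + ennreal B * nn_integral lborel ?b + ennreal B * K"
      using T by (simp add: nn_integral_add nn_integral_cmult nn_integral_cmult_indicator K_def)
    also have "\<dots> \<le> ennreal (\<Psi> 1) * ennreal T + ennreal B * 1 + ennreal B * K"
      using N_int by (intro add_mono mult_left_mono) auto
    also have "\<dots> = ennreal (\<Psi> 1 * T + B + B * enn2real K)"
      using T B \<Psi>1 K by (simp add: ennreal_mult ennreal_enn2real)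
    also have "\<dots> \<le> ennreal C"
      by (intro ennreal_leI) (simp add: C_def)
    finally show "n_functional \<Psi> N \<le> ennreal C" .
  qed
qed

section \<open>From the normalized bound to the Orlicz norm\<close>

text \<open>For admissible \<open>l\<close>, replacing \<open>w\<close> by \<open>w / l\<close>
  turns \<open>N t\<close> into \<open>N (l * t)\<close> and meets the normalization in
  \<open>bound\<close>; scaling back costs a factor \<open>l\<close>, and the infimum over
  \<open>l\<close> is taken. Without an admissible \<open>l\<close> the norm is infinite.\<close>

lemma n_functional_le_orlicz_norm:
  fixes w :: "'a \<Rightarrow> real"
  assumes \<Psi>: "\<forall>s\<in>{0<..1}. 0 \<le> \<Psi> s" "mono_on {0<..1} (\<lambda>s. s * \<Psi> s)"
    and \<Phi>: "young_function \<Phi>" and C: "0 < C"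
    and bound: "\<And>N. \<lbrakk>antimono N; \<And>t. 0 \<le> N t; \<And>t. N t \<le> 1;
      (\<integral>\<^sup>+t\<in>{0..}. ennreal (right_deriv \<Phi> t) * ennreal (N t) \<partial>lborel) \<le> 1\<rbrakk>
      \<Longrightarrow> n_functional \<Psi> N \<le> ennreal C"
    and I: "I \<in> sets M" "0 < emeasure M I" "emeasure M I < \<infinity>"
    and w: "w \<in> borel_measurable (restrict_space M I)" "\<And>x. x \<in> I \<Longrightarrow> 0 \<le> w x"
  shows "n_functional \<Psi> (normalized_distribution M I w) \<le> ennreal C * orlicz_norm \<Phi> M I w"
proof -
  let ?N = "normalized_distribution M I w"
  have conv: "convex_on {0..} \<Phi>" and mono: "mono_on {0..} \<Phi>" and cont: "continuous_on {0..} \<Phi>"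
    and \<Phi>0: "\<Phi> 0 = 0"
    using \<Phi> by (auto simp: young_function_def)
  have I_fm: "I \<in> fmeasurable M"
    using I by (simp add: fmeasurable_def)
  have I_space: "I \<inter> space M \<in> sets M" "space (restrict_space M I) = I"
    using sets.sets_into_space[OF I(1)] I(1) by (auto simp: space_restrict_space)
  have "{x \<in> space (restrict_space M I). t < w x} \<in> sets (restrict_space M I)" for t
    using w(1) by measurable
  then have sets: "{x \<in> I. t < w x} \<in> sets M" for t
    by (auto simp: I_space sets_restrict_space_iff)
  have fm: "{x \<in> I. t < w x} \<in> fmeasurable M" for t
    by (rule fmeasurableI2[OF I_fm _ sets]) auto
  have mI: "0 < measure M I"
    using I by (simp add: measure_def enn2real_positive_iff)
  have N: "antimono ?N" "\<And>t. 0 \<le> ?N t" "\<And>t. ?N t \<le> 1"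
    unfolding normalized_distribution_def antimono_def using mI fm sets I_fm
    by (auto intro!: divide_right_mono measure_mono_fmeasurable simp: divide_le_eq_1)
  have N_emeasure: "ennreal (?N t) = emeasure M {x\<in>I. t < w x} / emeasure M I" for t
    using fm[of t] I_fm mI
    by (simp add: normalized_distribution_def emeasure_eq_measure2 divide_ennreal)
  have le: "n_functional \<Psi> ?N \<le> ennreal C * ennreal l"
    if l: "0 < l" "(\<integral>\<^sup>+x\<in>I. ennreal (\<Phi> (\<bar>w x\<bar> / l)) \<partial>M) / emeasure M I \<le> 1" for l
  proof -
    let ?w = "\<lambda>x. w x / l"
    define h where "h = (\<lambda>t. ennreal (right_deriv \<Phi> t) * ennreal (?N (l * t)) * indicator {0..} t)"
    have [measurable]: "h \<in> borel_measurable borel"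
    proof -
      note [measurable] = borel_measurable_mono_on_Ici[OF mono_on_right_deriv[OF conv mono]]
        borel_measurable_antimono[OF N(1)]
      have "(\<lambda>t. (ennreal (right_deriv \<Phi> t) * indicator {0..} t) * ennreal (?N (l * t)))
          \<in> borel_measurable borel"
        by measurable
      then show ?thesis
        by (simp add: h_def mult_ac)
    qed
    have cancel: "emeasure M I * (a / emeasure M I) = a" for a
      using I by (simp add: ennreal_times_divide mult.commute[of "emeasure M I"] mult_divide_eq_ennreal)
    \<comment> \<open>Multiplying by the measure of \<open>I\<close> undoes the normalization of the
      distribution function, so the Tonelli bound applies to \<open>w / l\<close>.\<close>
    have "emeasure M I * integral\<^sup>N lborel h = (\<integral>\<^sup>+t. emeasure M I * h t \<partial>lborel)"
      by (simp add: nn_integral_cmult)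
    also have "\<dots> = (\<integral>\<^sup>+t\<in>{0..}. ennreal (right_deriv \<Phi> t) * emeasure M {x\<in>I. t < ?w x} \<partial>lborel)"
    proof (rule nn_integral_cong)
      fix t
      have "emeasure M I * h t = ennreal (right_deriv \<Phi> t) * (emeasure M I * ennreal (?N (l * t))) * indicator {0..} t"
        by (simp add: h_def mult_ac)
      then show "emeasure M I * h t
          = ennreal (right_deriv \<Phi> t) * emeasure M {x\<in>I. t < ?w x} * indicator {0..} t"
        using l by (simp add: N_emeasure cancel less_divide_eq mult.commute)
    qed
    also have "\<dots> \<le> (\<integral>\<^sup>+x\<in>I. ennreal (\<Phi> (?w x) - \<Phi> 0) \<partial>M)"
      using l w I by (intro nn_integral_right_deriv_mult_emeasure_le conv mono cont) auto
    also have "\<dots> = (\<integral>\<^sup>+x\<in>I. ennreal (\<Phi> (\<bar>w x\<bar> / l)) \<partial>M)"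
      using w(2) by (intro nn_integral_cong) (simp add: \<Phi>0 indicator_def)
    finally have "emeasure M I * integral\<^sup>N lborel h / emeasure M I \<le> 1"
      using l(2) divide_right_mono_ennreal order_trans by blast
    then have "integral\<^sup>N lborel h \<le> 1"
      using I by (simp add: mult.commute[of "emeasure M I"] mult_divide_eq_ennreal)
    then have "n_functional \<Psi> (\<lambda>t. ?N (l * t)) \<le> ennreal C"
      using N l by (intro bound) (auto simp: antimono_def h_def)
    then show ?thesis
      using n_functional_scale[OF \<Psi> N l(1)] by (metis mult.commute mult_left_mono zero_le)
  qed
  \<comment> \<open>Moving \<open>C\<close> to the left makes the claim a lower bound for an
    infimum; \<open>C\<close> is positive and finite, so the division can be undone.\<close>
  have "n_functional \<Psi> ?N / ennreal C \<le> orlicz_norm \<Phi> M I w"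
    unfolding orlicz_norm_def using C le
    by (intro Inf_greatest) (auto intro!: divide_le_posI_ennreal)
  then have "ennreal C * (n_functional \<Psi> ?N / ennreal C) \<le> ennreal C * orlicz_norm \<Phi> M I w"
    by (intro mult_left_mono) auto
  then show ?thesis
    using C by (simp add: ennreal_times_divide mult_divide_eq_ennreal mult.commute[of "ennreal C"])
qed

theorem lemma1p1:
  fixes \<Psi> \<Phi> :: "real \<Rightarrow> real" and C0 :: real
  assumes "\<forall>s\<in>{0<..1}. 0 \<le> \<Psi> s"
    and "antimono_on {0<..1} \<Psi>"
    and "mono_on {0<..1} (\<lambda>s. s * \<Psi> s)"
    and "young_function \<Phi>"
    and "reciprocal_integrable_at_infinity \<Phi>"
    and "\<forall>\<^sub>F t in at_top. \<Psi> (1 / (\<Phi> t * right_deriv \<Phi> t)) \<le> C0 * right_deriv \<Phi> t"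
  shows "\<exists>C::real. 0 < C \<and>
    (\<forall>(n::nat) (I :: (nat \<Rightarrow> real) set) (w :: (nat \<Rightarrow> real) \<Rightarrow> real).
       1 \<le> n \<longrightarrow>
       I \<in> sets (lebesgue_Rn n) \<longrightarrow>
       0 < emeasure (lebesgue_Rn n) I \<longrightarrow> emeasure (lebesgue_Rn n) I < \<infinity> \<longrightarrow>
       w \<in> borel_measurable (restrict_space (lebesgue_Rn n) I) \<longrightarrow>
       (\<forall>x\<in>I. 0 \<le> w x) \<longrightarrow>
       n_functional \<Psi> (normalized_distribution (lebesgue_Rn n) I w)
         \<le> ennreal C * orlicz_norm \<Phi> (lebesgue_Rn n) I w)"
proof -
  obtain C :: real where "0 < C" and "\<And>N. \<lbrakk>antimono N; \<And>t. 0 \<le> N t; \<And>t. N t \<le> 1;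
      (\<integral>\<^sup>+t\<in>{0..}. ennreal (right_deriv \<Phi> t) * ennreal (N t) \<partial>lborel) \<le> 1\<rbrakk>
      \<Longrightarrow> n_functional \<Psi> N \<le> ennreal C"
    using n_functional_bounded[OF assms] by blast
  then show ?thesis
    using n_functional_le_orlicz_norm[OF assms(1,3,4)] by blast
qed

end
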